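(* Let $G$ be a connected graph of order $n$ with minimum degree $\delta\geq 2$, where $n\geq \max\{5\delta, \frac{2}{5}\delta^{2}+\delta\}$. If $\rho(G)\geq\rho(K_{\delta}\nabla(K_{n-2\delta}\cup\delta K_{1}))$, then $G$ is a $1$-tough graph, unless $G\cong K_{\delta}\nabla(K_{n-2\delta}\cup\delta K_{1})$.
   Context: Graphs are finite, simple and undirected. For a graph $G$, $A(G)$ is its adjacency matrix and $\rho(G)$, the spectral radius of $G$, is the largest eigenvalue of $A(G)$. $c(G)$ denotes the number of connected components of $G$. For a real number $t$, a graph $G$ is $t$-tough if $|S|\geq t\,c(G-S)$ for every subset $S\subseteq V(G)$ with $c(G-S)>1$ (so complete graphs are $t$-tough for every $t$). $K_m$ is the complete graph on $m$ vertices, $\cup$ denotes disjoint union, $mK_1$ is the disjoint union of $m$ copies of $K_1$, and $G_1\nabla G_2$ is the join of $G_1$ and $G_2$, obtained from their disjoint union by adding all edges between $V(G_1)$ and $V(G_2)$. *)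

theory Defs
  imports "Graph_Theory.Graph_Theory" "Jordan_Normal_Form.Spectral_Radius"
begin

text \<open>A finite simple undirected graph is a \<^typ>\<open>'a pair_pre_digraph\<close> satisfying
  \<^const>\<open>pair_graph\<close>: finite, symmetric and loop-free. An undirected edge \<open>uv\<close> is
  represented by the two arcs \<open>(u, v)\<close> and \<open>(v, u)\<close>.\<close>

definition graph_order :: "'a pair_pre_digraph \<Rightarrow> nat" where
  "graph_order G = card (pverts G)"

text \<open>By symmetry the out-degree of a vertex is the number of its neighbours.\<close>

definition min_degree :: "'a pair_pre_digraph \<Rightarrow> nat" where
  "min_degree G = Min (out_degree (with_proj G) ` pverts G)"

text \<open>The strongly connected components of a symmetric digraph are its connected components.
  They are nonempty by definition, so the null graph has none.\<close>

definition num_components :: "('a, 'b) pre_digraph \<Rightarrow> nat" where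
  "num_components H = card (pre_digraph.sccs H)"

definition tough :: "real \<Rightarrow> 'a pair_pre_digraph \<Rightarrow> bool" where
  "tough t G \<longleftrightarrow>
    (\<forall>S \<subseteq> pverts G. num_components (with_proj G \<restriction> (pverts G - S)) > 1 \<longrightarrow>
      real (card S) \<ge> t * real (num_components (with_proj G \<restriction> (pverts G - S))))"

text \<open>Library matrices are indexed by initial segments of the naturals, so the adjacency matrix
  depends on an enumeration \<open>vs\<close> of the vertices; its spectrum does not
  (lemma \<open>spectrum_adjacency_matrix\<close>).\<close>

definition adjacency_matrix :: "'a list \<Rightarrow> 'a pair_pre_digraph \<Rightarrow> real mat" where
  "adjacency_matrix vs G =
    mat (length vs) (length vs) (\<lambda>(i, j). if (vs ! i, vs ! j) \<in> parcs G then 1 else 0)"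

text \<open>The adjacency matrix is real symmetric, so all its complex eigenvalues are real and no
  eigenvalue is lost by working over the reals.\<close>

definition graph_spectral_radius :: "'a pair_pre_digraph \<Rightarrow> real" where
  "graph_spectral_radius G =
    Max (spectrum (adjacency_matrix (SOME vs. distinct vs \<and> set vs = pverts G) G))"

lemma eigenvalue_adjacency_matrix_iff:
  assumes "distinct vs" "set vs = pverts G"
  shows "eigenvalue (adjacency_matrix vs G) k \<longleftrightarrow>
    (\<exists>f. (\<exists>v\<in>pverts G. f v \<noteq> 0) \<and>
      (\<forall>u\<in>pverts G. (\<Sum>v\<in>pverts G. if (u, v) \<in> parcs G then f v else 0) = k * f u))"
    (is "?L \<longleftrightarrow> ?R")
proof -
  let ?n = "length vs"
  have bij: "bij_betw (\<lambda>i. vs ! i) {0..<?n} (pverts G)"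
    using assms by (intro bij_betw_nth) auto
  have dim: "dim_row (adjacency_matrix vs G) = ?n"
    by (simp add: adjacency_matrix_def)
  have row: "(adjacency_matrix vs G *\<^sub>v x) $ i =
      (\<Sum>v\<in>pverts G. if (vs ! i, v) \<in> parcs G then f v else 0)"
    if "i < ?n" "x \<in> carrier_vec ?n" "\<And>j. j < ?n \<Longrightarrow> x $ j = f (vs ! j)" for x i f
  proof -
    have "(adjacency_matrix vs G *\<^sub>v x) $ i =
        (\<Sum>j = 0..<?n. if (vs ! i, vs ! j) \<in> parcs G then f (vs ! j) else 0)"
      using that by (auto simp: adjacency_matrix_def scalar_prod_def intro!: sum.cong)
    also have "\<dots> = (\<Sum>v\<in>pverts G. if (vs ! i, v) \<in> parcs G then f v else 0)"
      by (rule sum.reindex_bij_betw[OF bij])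
    finally show ?thesis .
  qed
  show ?thesis
  proof
    assume ?L
    then obtain x where x: "x \<in> carrier_vec ?n" "x \<noteq> 0\<^sub>v ?n"
      "adjacency_matrix vs G *\<^sub>v x = k \<cdot>\<^sub>v x"
      by (auto simp: eigenvalue_def eigenvector_def dim)
    define f where "f v = x $ the_inv_into {0..<?n} (\<lambda>i. vs ! i) v" for v
    have f: "f (vs ! j) = x $ j" if "j < ?n" for j
      using that bij unfolding f_def by (simp add: bij_betw_def the_inv_into_f_f)
    obtain j where "j < ?n" "x $ j \<noteq> 0"
      using x(1,2) by (metis carrier_vecD eq_vecI index_zero_vec(1,2))
    then have "\<exists>v\<in>pverts G. f v \<noteq> 0"
      using f assms(2) nth_mem by metis
    moreover have "(\<Sum>v\<in>pverts G. if (u, v) \<in> parcs G then f v else 0) = k * f u"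
      if "u \<in> pverts G" for u
    proof -
      from that assms(2) obtain i where i: "i < ?n" "u = vs ! i"
        by (metis in_set_conv_nth)
      have "(\<Sum>v\<in>pverts G. if (u, v) \<in> parcs G then f v else 0) = (k \<cdot>\<^sub>v x) $ i"
        using row[OF i(1) x(1), of f] f i(2) x(3) by simp
      then show ?thesis
        using i x(1) f by simp
    qed
    ultimately show ?R by blast
  next
    assume ?R
    then obtain f where f: "\<exists>v\<in>pverts G. f v \<noteq> 0"
      "\<And>u. u \<in> pverts G \<Longrightarrow>
        (\<Sum>v\<in>pverts G. if (u, v) \<in> parcs G then f v else 0) = k * f u"
      by blast
    define x where "x = vec ?n (\<lambda>i. f (vs ! i))"
    have x: "x \<in> carrier_vec ?n" by (simp add: x_def)
    obtain i where "i < ?n" "f (vs ! i) \<noteq> 0"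
      using f(1) assms(2) by (metis in_set_conv_nth)
    then have "x \<noteq> 0\<^sub>v ?n"
      by (metis index_vec index_zero_vec(1) x_def)
    moreover have "adjacency_matrix vs G *\<^sub>v x = k \<cdot>\<^sub>v x"
    proof (rule eq_vecI)
      fix i assume "i < dim_vec (k \<cdot>\<^sub>v x)"
      then have i: "i < ?n" by (simp add: x_def)
      then have "vs ! i \<in> pverts G" using assms(2) nth_mem by blast
      then show "(adjacency_matrix vs G *\<^sub>v x) $ i = (k \<cdot>\<^sub>v x) $ i"
        using row[OF i x, of f] f(2) i by (simp add: x_def)
    qed (simp add: x_def dim)
    ultimately show ?L
      using x by (auto simp: eigenvalue_def eigenvector_def dim)
  qed
qed

lemma spectrum_adjacency_matrix:
  assumes "distinct vs" "set vs = pverts G" "distinct ws" "set ws = pverts G"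
  shows "spectrum (adjacency_matrix vs G) = spectrum (adjacency_matrix ws G)"
  unfolding spectrum_def set_eq_iff mem_Collect_eq
    eigenvalue_adjacency_matrix_iff[OF assms(1,2)] eigenvalue_adjacency_matrix_iff[OF assms(3,4)]
  by blast

definition complete_graph :: "nat \<Rightarrow> nat pair_pre_digraph" where
  "complete_graph m = \<lparr>pverts = {..<m}, parcs = {(u, v). u < m \<and> v < m \<and> u \<noteq> v}\<rparr>"

definition disjoint_union ::
  "'a pair_pre_digraph \<Rightarrow> 'b pair_pre_digraph \<Rightarrow> ('a + 'b) pair_pre_digraph" where
  "disjoint_union G H =
    \<lparr>pverts = Inl ` pverts G \<union> Inr ` pverts H,
     parcs = map_prod Inl Inl ` parcs G \<union> map_prod Inr Inr ` parcs H\<rparr>"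

definition graph_join ::
  "'a pair_pre_digraph \<Rightarrow> 'b pair_pre_digraph \<Rightarrow> ('a + 'b) pair_pre_digraph" where
  "graph_join G H =
    \<lparr>pverts = pverts (disjoint_union G H),
     parcs = parcs (disjoint_union G H)
       \<union> Inl ` pverts G \<times> Inr ` pverts H \<union> Inr ` pverts H \<times> Inl ` pverts G\<rparr>"

text \<open>The disjoint union of \<open>m\<close> copies of \<open>G\<close>.\<close>

definition graph_copies :: "nat \<Rightarrow> 'a pair_pre_digraph \<Rightarrow> (nat \<times> 'a) pair_pre_digraph" where
  "graph_copies m G =
    \<lparr>pverts = {..<m} \<times> pverts G,
     parcs = {((i, u), (i, v)) | i u v. i < m \<and> (u, v) \<in> parcs G}\<rparr>"

text \<open>The graph \<open>K\<^sub>d \<nabla> (K\<^bsub>n - 2d\<^esub> \<union> d K\<^sub>1)\<close>; the subtraction truncates unless \<open>n \<ge> 2d\<close>.\<close>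

definition extremal_graph :: "nat \<Rightarrow> nat \<Rightarrow> (nat + nat + nat \<times> nat) pair_pre_digraph" where
  "extremal_graph n d =
    graph_join (complete_graph d)
      (disjoint_union (complete_graph (n - 2 * d)) (graph_copies d (complete_graph 1)))"

lemma pair_graph_iff:
  "pair_graph G \<longleftrightarrow>
    finite (pverts G) \<and> parcs G \<subseteq> pverts G \<times> pverts G \<and> sym (parcs G) \<and> irrefl (parcs G)"
    (is "_ \<longleftrightarrow> ?R")
proof
  assume "pair_graph G"
  then interpret pair_graph G .
  show ?R
    using pair_finite_verts pair_sym_arcs no_loops'
    by (auto simp: symmetric_def irrefl_def dest: wellformed')
next
  assume R: ?R
  then have "finite (parcs G)"
    by (meson finite_SigmaI finite_subset)
  with R show "pair_graph G"
    by unfold_locales (auto simp: symmetric_def irrefl_def)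
qed

lemma pair_graph_complete_graph: "pair_graph (complete_graph m)"
  by (auto simp: pair_graph_iff complete_graph_def sym_def irrefl_def)

lemma pair_graph_disjoint_union:
  "pair_graph G \<Longrightarrow> pair_graph H \<Longrightarrow> pair_graph (disjoint_union G H)"
  unfolding pair_graph_iff disjoint_union_def sym_def irrefl_def by (auto 0 3)

lemma pair_graph_graph_join:
  "pair_graph G \<Longrightarrow> pair_graph H \<Longrightarrow> pair_graph (graph_join G H)"
  unfolding pair_graph_iff graph_join_def disjoint_union_def sym_def irrefl_def by (auto 0 3)

lemma pair_graph_graph_copies: "pair_graph G \<Longrightarrow> pair_graph (graph_copies m G)"
  unfolding pair_graph_iff graph_copies_def sym_def irrefl_def by auto

lemma pair_graph_extremal_graph: "pair_graph (extremal_graph n d)"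
  unfolding extremal_graph_def
  by (intro pair_graph_graph_join pair_graph_disjoint_union pair_graph_graph_copies
      pair_graph_complete_graph)

end

theory Submission
  imports Defs
begin

text \<open>Let \<open>t - 1\<close> be the eigenvalue of the extremal graph with \<open>n - \<delta> < t < n\<close>. If \<open>G\<close> is not
  1-tough, some \<open>S\<close> with \<open>s\<close> elements leaves at least \<open>s + 1\<close> components, each of size at least
  \<open>max 1 (\<delta> + 1 - s)\<close>. Give weight \<open>1\<close> to \<open>S\<close> and weight \<open>s / (t - x)\<close> to a component of size
  \<open>x\<close>. By convexity of \<open>x / (t - x)\<close> the worst case is that all components but one are as small as
  possible; in that case the hypotheses on \<open>n\<close> make this positive weight a supersolution for
  \<open>t - 1\<close>, strictly unless \<open>s = \<delta>\<close>. A positive supersolution on a connected graph bounds every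
  eigenvalue, and a bound that is attained forces equality at every vertex, hence
  the isomorphism with the extremal graph.\<close>

section \<open>Spectral radius, eigenfunctions and positive supersolutions\<close>

text \<open>Over the complex numbers an eigenvalue \<open>k\<close> with eigenvector
  \<open>x\<close> exists. Symmetry makes the form \<open>x* A x\<close> real, and it equals
  \<open>k\<close> times the squared norm of \<open>x\<close>, so \<open>k\<close> is real and a
  root of the real characteristic polynomial.\<close>

lemma symmetric_real_mat_spectrum_non_empty:
  fixes A :: "real mat"
  assumes A: "A \<in> carrier_mat n n" and sym: "\<And>i j. i < n \<Longrightarrow> j < n \<Longrightarrow> A $$ (i, j) = A $$ (j, i)"
    and n: "n > 0"
  shows "spectrum A \<noteq> {}"
proof -
  let ?C = "map_mat complex_of_real A"
  have C: "?C \<in> carrier_mat n n" using A by simp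
  obtain k where k: "eigenvalue ?C k"
    using spectrum_non_empty[OF C n] by (auto simp: spectrum_def)
  then obtain x where x: "x \<in> carrier_vec n" "x \<noteq> 0\<^sub>v n" "?C *\<^sub>v x = k \<cdot>\<^sub>v x"
    using A by (auto simp: eigenvalue_def eigenvector_def)
  have row: "(\<Sum>j<n. of_real (A $$ (i, j)) * x $ j) = k * x $ i" if "i < n" for i
  proof -
    have "(\<Sum>j<n. of_real (A $$ (i, j)) * x $ j) = (?C *\<^sub>v x) $ i"
      using that A x(1) by (auto simp: scalar_prod_def atLeast0LessThan intro!: sum.cong)
    then show ?thesis using x that by simp
  qed
  \<comment> \<open>\<open>q\<close> is the Hermitian form \<open>x* A x\<close>; swapping the two
    sums conjugates it.\<close>
  define q where "q = (\<Sum>i<n. cnj (x $ i) * (k * x $ i))"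
  have q: "q = (\<Sum>i<n. \<Sum>j<n. cnj (x $ i) * of_real (A $$ (i, j)) * x $ j)"
    unfolding q_def by (simp add: row[symmetric] sum_distrib_left mult.assoc)
  also have "\<dots> = (\<Sum>j<n. \<Sum>i<n. cnj (x $ i) * of_real (A $$ (i, j)) * x $ j)"
    by (rule sum.swap)
  also have "\<dots> = cnj q"
    unfolding q using sym by (auto intro!: sum.cong simp: mult_ac)
  finally have "q = cnj q" .
  define w where "w = (\<Sum>i<n. (cmod (x $ i))\<^sup>2)"
  have "q = k * of_real w"
    by (simp add: q_def w_def sum_distrib_left mult_ac complex_norm_square del: of_real_power)
  moreover have "w > 0"
  proof -
    obtain i where "i < n" "x $ i \<noteq> 0"
      using x(1,2) by (metis carrier_vecD eq_vecI index_zero_vec)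
    then show ?thesis unfolding w_def by (intro sum_pos2[of _ i]) auto
  qed
  ultimately have "k = cnj k"
    using \<open>q = cnj q\<close> by simp
  then obtain r where r: "k = of_real r"
    by (metis Reals_cases Reals_cnj_iff)
  have "poly (map_poly complex_of_real (char_poly A)) (of_real r) = 0"
    using k unfolding eigenvalue_root_char_poly[OF C] of_real_hom.char_poly_hom[OF A] r .
  then have "poly (char_poly A) r = 0"
    by simp
  then show ?thesis
    by (auto simp: spectrum_def eigenvalue_root_char_poly[OF A])
qed

text \<open>An eigenvector indexed by the vertices themselves, in the form given by
  \<open>eigenvalue_adjacency_matrix_iff\<close>, so that no enumeration has to be chosen.\<close>

definition eigenfunction :: "'a pair_pre_digraph \<Rightarrow> real \<Rightarrow> ('a \<Rightarrow> real) \<Rightarrow> bool" where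
  "eigenfunction G k f \<longleftrightarrow> (\<exists>v\<in>pverts G. f v \<noteq> 0) \<and>
    (\<forall>u\<in>pverts G. (\<Sum>v\<in>pverts G. if (u, v) \<in> parcs G then f v else 0) = k * f u)"

text \<open>The spectrum is finite and nonempty, so the \<open>Max\<close> in the definition is
  attained. Later arguments use the spectral radius only through these two facts.\<close>

lemma
  assumes "pair_graph G" "pverts G \<noteq> {}"
  shows graph_spectral_radius_eigenfunction: "\<exists>f. eigenfunction G (graph_spectral_radius G) f"
    and eigenfunction_le_graph_spectral_radius:
      "eigenfunction G k f \<Longrightarrow> k \<le> graph_spectral_radius G"
proof -
  have fin: "finite (pverts G)" and sym: "sym (parcs G)"
    using assms(1) by (auto simp: pair_graph_iff)
  define vs where "vs = (SOME vs. distinct vs \<and> set vs = pverts G)"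
  have "\<exists>vs. distinct vs \<and> set vs = pverts G"
    using finite_distinct_list[OF fin] by blast
  then have vs: "distinct vs" "set vs = pverts G"
    unfolding vs_def by (metis (mono_tags, lifting) someI_ex)+
  let ?A = "adjacency_matrix vs G"
  have A: "?A \<in> carrier_mat (length vs) (length vs)"
    by (simp add: adjacency_matrix_def)
  have ev: "k \<in> spectrum ?A \<longleftrightarrow> (\<exists>f. eigenfunction G k f)" for k
    by (simp add: spectrum_def eigenvalue_adjacency_matrix_iff[OF vs] eigenfunction_def)
  have "spectrum ?A \<noteq> {}"
  proof (rule symmetric_real_mat_spectrum_non_empty[OF A])
    show "length vs > 0" using vs(2) assms(2) by auto
  qed (use sym in \<open>auto simp: adjacency_matrix_def dest: symD\<close>)
  moreover have "finite (spectrum ?A)"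
    using card_finite_spectrum(1)[OF A] .
  moreover have "graph_spectral_radius G = Max (spectrum ?A)"
    by (simp add: graph_spectral_radius_def vs_def)
  ultimately show "\<exists>f. eigenfunction G (graph_spectral_radius G) f"
      "eigenfunction G k f \<Longrightarrow> k \<le> graph_spectral_radius G"
    using Max_in ev by (auto intro!: Max_ge)
qed

text \<open>Scale \<open>y\<close> to the smallest multiple \<open>M y\<close> that dominates
  \<open>|f|\<close>. Where the two touch, \<open>r M y = r |f| \<le> |k| |f| = |A f| \<le> A |f|
  \<le> M (A y) \<le> r M y\<close>, with \<open>A\<close> the adjacency operator. Hence all links
  are equalities: \<open>y\<close> solves the equation there, and every neighbour is a touching
  point too. Connectedness spreads this to all vertices.\<close>

lemma eigenfunction_supersolution_eq:
  assumes ef: "eigenfunction G k f" and fin: "finite (pverts G)"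
    and conn: "\<And>X. X \<subseteq> pverts G \<Longrightarrow> X \<noteq> {} \<Longrightarrow>
      (\<And>u v. u \<in> X \<Longrightarrow> v \<in> pverts G \<Longrightarrow> (u, v) \<in> parcs G \<Longrightarrow> v \<in> X) \<Longrightarrow> X = pverts G"
    and pos: "\<And>v. v \<in> pverts G \<Longrightarrow> 0 < y v"
    and super: "\<And>u. u \<in> pverts G \<Longrightarrow>
      (\<Sum>v\<in>pverts G. if (u, v) \<in> parcs G then y v else 0) \<le> r * y u"
    and "r \<le> k" and u: "u \<in> pverts G"
  shows "(\<Sum>v\<in>pverts G. if (u, v) \<in> parcs G then y v else 0) = r * y u"
proof -
  let ?V = "pverts G"
  define M where "M = Max ((\<lambda>v. \<bar>f v\<bar> / y v) ` ?V)"
  have M_ge: "\<bar>f v\<bar> \<le> M * y v" if "v \<in> ?V" for v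
  proof -
    have "\<bar>f v\<bar> / y v \<le> M"
      unfolding M_def using fin that by (intro Max_ge) auto
    then show ?thesis using pos[OF that] by (simp add: pos_divide_le_eq)
  qed
  obtain v0 where v0: "v0 \<in> ?V" "f v0 \<noteq> 0"
    using ef by (auto simp: eigenfunction_def)
  have M: "M > 0"
  proof (rule ccontr)
    assume "\<not> M > 0"
    then have "M * y v0 \<le> 0" using pos[OF v0(1)] by (simp add: mult_le_0_iff)
    then show False using M_ge[OF v0(1)] v0(2) by simp
  qed
  define X where "X = {v \<in> ?V. \<bar>f v\<bar> = M * y v}"
  have step: "(\<Sum>v\<in>?V. if (u, v) \<in> parcs G then y v else 0) = r * y u \<and>
      (\<forall>v\<in>?V. (u, v) \<in> parcs G \<longrightarrow> v \<in> X)" if "u \<in> X" for u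
  proof -
    have uV: "u \<in> ?V" and fu: "\<bar>f u\<bar> = M * y u" using that by (auto simp: X_def)
    define a where "a v = (if (u, v) \<in> parcs G then 1 else (0 :: real))" for v
    have if_mult: "(if (u, v) \<in> parcs G then g v else 0) = a v * g v" for g :: "_ \<Rightarrow> real" and v
      by (simp add: a_def)
    have Af: "(\<Sum>v\<in>?V. a v * f v) = k * f u"
      using ef uV unfolding eigenfunction_def if_mult[symmetric] by blast
    have a_nonneg: "0 \<le> a v" for v
      by (simp add: a_def)
    have 1: "M * (r * y u) \<le> (\<Sum>v\<in>?V. a v * \<bar>f v\<bar>)"
    proof -
      have "r * \<bar>f u\<bar> \<le> \<bar>k\<bar> * \<bar>f u\<bar>"
        using \<open>r \<le> k\<close> by (intro mult_right_mono) auto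
      also have "\<dots> = \<bar>\<Sum>v\<in>?V. a v * f v\<bar>"
        unfolding Af by (simp add: abs_mult)
      also have "\<dots> \<le> (\<Sum>v\<in>?V. a v * \<bar>f v\<bar>)"
        by (rule order.trans[OF sum_abs]) (simp add: abs_mult a_nonneg)
      finally show ?thesis by (simp add: fu mult.left_commute)
    qed
    have 2: "(\<Sum>v\<in>?V. a v * \<bar>f v\<bar>) \<le> (\<Sum>v\<in>?V. a v * (M * y v))"
      by (intro sum_mono mult_left_mono M_ge a_nonneg)
    have 3: "(\<Sum>v\<in>?V. a v * (M * y v)) = M * (\<Sum>v\<in>?V. a v * y v)"
      by (simp add: sum_distrib_left mult_ac)
    have 4: "M * (\<Sum>v\<in>?V. a v * y v) \<le> M * (r * y u)"
      using super[OF uV] M unfolding if_mult by (intro mult_left_mono) auto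
    have "M * (\<Sum>v\<in>?V. a v * y v) = M * (r * y u)"
      using 1 2 3 4 by linarith
    then have A: "(\<Sum>v\<in>?V. a v * y v) = r * y u" using M by simp
    \<comment> \<open>The terms are nonnegative with sum 0, so each vanishes; at the neighbours of
      \<open>u\<close>, where \<open>a v = 1\<close>, this says that they lie in
      \<open>X\<close>.\<close>
    have "(\<Sum>v\<in>?V. a v * (M * y v) - a v * \<bar>f v\<bar>) = 0"
      unfolding sum_subtractf using 1 2 3 4 by linarith
    moreover have "0 \<le> a v * (M * y v) - a v * \<bar>f v\<bar>" if "v \<in> ?V" for v
      using M_ge[OF that] by (simp add: a_def)
    ultimately have B: "\<forall>v\<in>?V. a v * (M * y v) - a v * \<bar>f v\<bar> = 0"
      using fin by (subst (asm) sum_nonneg_eq_0_iff) auto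
    then have "\<forall>v\<in>?V. (u, v) \<in> parcs G \<longrightarrow> v \<in> X"
      by (auto simp: X_def a_def)
    then show ?thesis using A unfolding if_mult by blast
  qed
  \<comment> \<open>\<open>X\<close> is nonempty because the maximum \<open>M\<close> is attained,
    and closed under adjacency by \<open>step\<close>.\<close>
  have "X = ?V"
  proof (rule conn)
    have "M \<in> (\<lambda>v. \<bar>f v\<bar> / y v) ` ?V"
      unfolding M_def using fin v0(1) by (intro Max_in) auto
    then obtain v where "v \<in> ?V" "M = \<bar>f v\<bar> / y v" by blast
    then have "v \<in> X" using pos[of v] by (simp add: X_def)
    then show "X \<noteq> {}" by blast
  qed (use step in \<open>auto simp: X_def\<close>)
  then show ?thesis using step u by blast
qed

section \<open>Connectivity and components\<close>

text \<open>Connectedness is strong connectedness of the symmetric closure, and a symmetric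
  \<open>G\<close> is its own symmetric closure. So every vertex is reachable from a point of
  \<open>X\<close>, and closedness carries membership along the path.\<close>

lemma connected_closed_eq:
  assumes "pair_graph G" and "Digraph_Component.connected (with_proj G)"
    and "X \<subseteq> pverts G" "X \<noteq> {}"
    and closed: "\<And>u v. u \<in> X \<Longrightarrow> v \<in> pverts G \<Longrightarrow> (u, v) \<in> parcs G \<Longrightarrow> v \<in> X"
  shows "X = pverts G"
proof -
  interpret pair_graph G by fact
  have "mk_symmetric (with_proj G) = G"
    using arcs_symmetric by (auto intro!: pair_pre_digraph.equality simp: mk_symmetric_def)
  then have "strongly_connected (with_proj G)"
    using assms(2) by (simp add: connected_def)
  then have reach: "u \<rightarrow>\<^sup>*\<^bsub>with_proj G\<^esub> v" if "u \<in> pverts G" "v \<in> pverts G" for u v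
    using that by (auto simp: strongly_connected_def)
  obtain u where u: "u \<in> X" using \<open>X \<noteq> {}\<close> by blast
  have "v \<in> X" if "v \<in> pverts G" for v
  proof -
    have "u \<rightarrow>\<^sup>*\<^bsub>with_proj G\<^esub> v" using reach u that \<open>X \<subseteq> pverts G\<close> by blast
    then show ?thesis
    proof (induction rule: reachable_induct)
      case base
      then show ?case using u by simp
    next
      case (step x y)
      then show ?case using closed[of x y] wellformed'(2)[of x y] by simp
    qed
  qed
  then show ?thesis using \<open>X \<subseteq> pverts G\<close> by blast
qed

text \<open>The induced subgraph is rewritten as a pair graph \<open>H\<close>, whose strong
  components have the vertex sets \<open>P\<close>. Arcs come in both directions, so adjacent
  vertices reach each other and share a component.\<close>

lemma induced_components_partition:
  assumes "pair_graph G" and "W \<subseteq> pverts G"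
  obtains P where "num_components (with_proj G \<restriction> W) = card P" "finite P" "\<Union>P = W" "disjoint P"
    "{} \<notin> P" "\<And>X u v. X \<in> P \<Longrightarrow> u \<in> X \<Longrightarrow> v \<in> W \<Longrightarrow> (u, v) \<in> parcs G \<Longrightarrow> v \<in> X"
proof -
  define H where "H = \<lparr>pverts = W, parcs = {(u, v) \<in> parcs G. u \<in> W \<and> v \<in> W}\<rparr>"
  have H: "with_proj G \<restriction> W = with_proj H"
    by (auto simp: induce_subgraph_def with_proj_def H_def)
  have "pair_graph H"
    using assms by (auto simp: pair_graph_iff H_def sym_def irrefl_def intro: finite_subset)
  then interpret H: pair_graph H .
  let ?P = "pre_digraph.sccs_verts (with_proj H)"
  have "num_components (with_proj G \<restriction> W) = card ?P"
    by (simp add: num_components_def H H.card_sccs_verts)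
  moreover have "finite ?P"
    by (rule H.finite_sccs_verts)
  moreover have "\<Union>?P = W"
  proof -
    have "X \<subseteq> W" if "X \<in> ?P" for X
      using H.sccs_verts_subsets[OF that] by (simp add: H_def)
    moreover have "\<exists>X\<in>?P. u \<in> X" if "u \<in> W" for u
      using H.scc_of_in_sccs_verts[of u] H.in_scc_of_self[of u] that by (auto simp: H_def)
    ultimately show ?thesis by blast
  qed
  moreover have "disjoint ?P"
    using H.sccs_verts_disjoint by (auto simp: disjoint_def)
  moreover have "{} \<notin> ?P"
    by (simp add: H.in_sccs_verts_conv_reachable)
  moreover have "v \<in> X" if "X \<in> ?P" "u \<in> X" "v \<in> W" "(u, v) \<in> parcs G" for X u v
  proof -
    have "X \<subseteq> W"
      using H.sccs_verts_subsets[OF that(1)] by (simp add: H_def)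
    then have uv: "(u, v) \<in> parcs H" using that by (auto simp: H_def)
    then have "u \<rightarrow>\<^sup>*\<^bsub>with_proj H\<^esub> v" "v \<rightarrow>\<^sup>*\<^bsub>with_proj H\<^esub> u"
      using H.arcs_symmetric by (auto intro!: H.reachable_adjI)
    then show ?thesis
      using that(1,2) unfolding H.in_sccs_verts_conv_reachable by blast
  qed
  ultimately show ?thesis by (rule that)
qed

section \<open>Recognising the extremal graph\<close>

text \<open>Arcs are pairs of vertices, so the vertex bijection already fixes the arc map as
  \<open>map_prod \<phi> \<phi>\<close>.\<close>

lemma digraph_iso_with_projI:
  assumes "pair_wf_digraph G" and bij: "bij_betw \<phi> (pverts G) (pverts H)"
    and arcs: "parcs H = map_prod \<phi> \<phi> ` parcs G"
  shows "digraph_iso (with_proj G) (with_proj H)"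
proof -
  let ?h = "\<lparr>iso_verts = \<phi>, iso_arcs = map_prod \<phi> \<phi>, iso_head = snd, iso_tail = fst\<rparr>"
  have inj: "inj_on \<phi> (pverts G)" using bij by (rule bij_betw_imp_inj_on)
  have wf: "parcs G \<subseteq> pverts G \<times> pverts G"
    using assms(1) by (auto simp: pair_wf_digraph_def)
  have "inj_on (map_prod \<phi> \<phi>) (parcs G)"
    using map_prod_inj_on[OF inj inj] wf by (rule inj_on_subset)
  then have "pre_digraph.digraph_isomorphism (with_proj G) ?h"
    using inj assms(1) by (auto simp: pre_digraph.digraph_isomorphism_def wf_digraph_wp_iff)
  moreover have "with_proj H = app_iso ?h (with_proj G)"
    using bij arcs by (simp add: app_iso_def with_proj_def bij_betw_def)
  ultimately show ?thesis by (auto simp: digraph_iso_def)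
qed

lemma pverts_extremal_graph:
  "pverts (extremal_graph n d) =
    Inl ` {..<d} \<union> Inr ` (Inl ` {..<n - 2 * d} \<union> Inr ` ({..<d} \<times> {0}))"
  by (auto simp: extremal_graph_def graph_join_def disjoint_union_def graph_copies_def
      complete_graph_def)

text \<open>\<open>isl u\<close> marks the join factor and \<open>isl (projr u)\<close> the clique.
  The unspecified value of \<open>projr\<close> on an \<open>Inl\<close> vertex does no harm, since
  such a vertex already makes the disjunction true.\<close>

lemma parcs_extremal_graph:
  "(u, v) \<in> parcs (extremal_graph n d) \<longleftrightarrow>
    u \<in> pverts (extremal_graph n d) \<and> v \<in> pverts (extremal_graph n d) \<and> u \<noteq> v \<and>
    (isl u \<or> isl v \<or> isl (projr u) \<and> isl (projr v))"
  unfolding extremal_graph_def graph_join_def disjoint_union_def graph_copies_def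
      complete_graph_def
  by (cases u; cases v; cases "projr u"; cases "projr v") auto

text \<open>Adjacency of distinct vertices depends only on their blocks, so any bijections from
  \<open>S\<close>, \<open>L\<close>, \<open>R\<close> to the join factor, the clique and the
  isolated vertices combine to an isomorphism.\<close>

lemma digraph_iso_extremal_graphI:
  assumes "pair_graph G" and V: "pverts G = S \<union> L \<union> R"
    and disj: "S \<inter> L = {}" "S \<inter> R = {}" "L \<inter> R = {}"
    and card: "card S = d" "card L = n - 2 * d" "card R = d"
    and arcs: "\<And>u v. u \<in> pverts G \<Longrightarrow> v \<in> pverts G \<Longrightarrow>
      (u, v) \<in> parcs G \<longleftrightarrow> u \<noteq> v \<and> (u \<in> S \<or> v \<in> S \<or> u \<in> L \<and> v \<in> L)"
  shows "digraph_iso (with_proj G) (with_proj (extremal_graph n d))"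
proof -
  interpret pair_graph G by fact
  have fin: "finite S" "finite L" "finite R" using V pair_finite_verts by auto
  obtain f where f: "bij_betw f S {..<d}"
    using ex_bij_betw_finite_nat[OF fin(1)] card by (auto simp: atLeast0LessThan)
  obtain g where g: "bij_betw g L {..<n - 2 * d}"
    using ex_bij_betw_finite_nat[OF fin(2)] card by (auto simp: atLeast0LessThan)
  obtain h where h: "bij_betw h R {..<d}"
    using ex_bij_betw_finite_nat[OF fin(3)] card by (auto simp: atLeast0LessThan)
  define \<phi> where "\<phi> v = (if v \<in> S then Inl (f v) else if v \<in> L then Inr (Inl (g v))
    else Inr (Inr (h v, 0::nat)))" for v
  have \<phi>: "\<phi> v = Inl (f v)" if "v \<in> S" for v using that by (simp add: \<phi>_def)
  have \<phi>L: "\<phi> v = Inr (Inl (g v))" if "v \<in> L" for v using that disj by (auto simp: \<phi>_def)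
  have \<phi>R: "\<phi> v = Inr (Inr (h v, 0))" if "v \<in> R" for v using that disj by (auto simp: \<phi>_def)
  have "bij_betw \<phi> S (Inl ` {..<d})"
    using f \<phi> by (auto simp: bij_betw_def inj_on_def image_iff)
  moreover have "bij_betw \<phi> L (Inr ` Inl ` {..<n - 2 * d})"
    using g \<phi>L by (auto simp: bij_betw_def inj_on_def image_iff)
  moreover have "bij_betw \<phi> R (Inr ` Inr ` ({..<d} \<times> {0}))"
    using h \<phi>R by (auto simp: bij_betw_def inj_on_def image_iff)
  ultimately have "bij_betw \<phi> (S \<union> L \<union> R)
      (Inl ` {..<d} \<union> Inr ` Inl ` {..<n - 2 * d} \<union> Inr ` Inr ` ({..<d} \<times> {0}))"
    by (intro bij_betw_combine) auto
  then have bij: "bij_betw \<phi> (pverts G) (pverts (extremal_graph n d))"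
    by (simp add: V pverts_extremal_graph image_Un Un_assoc)
  have isl: "isl (\<phi> v) \<longleftrightarrow> v \<in> S" "v \<notin> S \<Longrightarrow> isl (projr (\<phi> v)) \<longleftrightarrow> v \<in> L" for v
    by (auto simp: \<phi>_def)
  have iff: "(\<phi> u, \<phi> v) \<in> parcs (extremal_graph n d) \<longleftrightarrow> (u, v) \<in> parcs G"
    if "u \<in> pverts G" "v \<in> pverts G" for u v
  proof -
    have "\<phi> u \<in> pverts (extremal_graph n d)" "\<phi> v \<in> pverts (extremal_graph n d)"
      using bij that by (auto simp: bij_betw_def)
    moreover have "\<phi> u = \<phi> v \<longleftrightarrow> u = v"
      using bij that by (auto simp: bij_betw_def inj_on_def)
    ultimately show ?thesis
      unfolding parcs_extremal_graph arcs[OF that] using isl by blast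
  qed
  have "parcs (extremal_graph n d) = map_prod \<phi> \<phi> ` parcs G"
  proof (intro Set.set_eqI iffI)
    fix e assume e: "e \<in> parcs (extremal_graph n d)"
    then have "fst e \<in> \<phi> ` pverts G" "snd e \<in> \<phi> ` pverts G"
      using bij parcs_extremal_graph[of "fst e" "snd e"] by (auto simp: bij_betw_def)
    then obtain u v where "u \<in> pverts G" "v \<in> pverts G" "e = (\<phi> u, \<phi> v)"
      by (metis imageE prod.collapse)
    then show "e \<in> map_prod \<phi> \<phi> ` parcs G"
      using iff e by force
  next
    fix e assume "e \<in> map_prod \<phi> \<phi> ` parcs G"
    then show "e \<in> parcs (extremal_graph n d)"
      using iff wellformed' by auto
  qed
  then show ?thesis
    by (rule digraph_iso_with_projI[OF pair_wf_digraph bij])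
qed

lemma sum_pverts_extremal_graph:
  fixes g :: "_ \<Rightarrow> real"
  shows "sum g (pverts (extremal_graph n d)) =
    (\<Sum>i<d. g (Inl i)) + ((\<Sum>j<n - 2 * d. g (Inr (Inl j))) + (\<Sum>i<d. g (Inr (Inr (i, 0)))))"
proof -
  have un: "sum h (Inl ` A \<union> Inr ` B) = sum (h \<circ> Inl) A + sum (h \<circ> Inr) B"
    if "finite A" "finite B" for h :: "'x + 'y \<Rightarrow> real" and A B
    using that by (subst sum.union_disjoint) (auto simp: sum.reindex)
  have "{..<d} \<times> {0} = (\<lambda>i. (i, 0 :: nat)) ` {..<d}" by auto
  then have "sum h ({..<d} \<times> {0 :: nat}) = (\<Sum>i<d. h (i, 0))" for h :: "_ \<Rightarrow> real"
    by (simp add: sum.reindex inj_on_def)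
  then show ?thesis
    unfolding pverts_extremal_graph by (simp add: un)
qed

section \<open>Convexity: the worst distribution of component sizes\<close>

text \<open>All sizes lie in \<open>[m, B]\<close>, where the convex function
  \<open>x / (t - x)\<close> stays below its chord. Summing the chord depends only on
  \<open>N\<close> and the number of parts; it gives \<open>Z\<close> for \<open>s + 1\<close> parts
  and less for more. Equality leaves only the endpoints \<open>m\<close> and
  \<open>B\<close>.\<close>

lemma sum_convex_chord:
  fixes x :: "'b \<Rightarrow> real" and m B t N :: real and s :: nat
  assumes "finite P" and "s < card P" and sum: "sum x P = N" and m: "\<And>p. p \<in> P \<Longrightarrow> m \<le> x p"
    and "m > 0" and B: "B = N - s * m" and t: "B < t"
  defines "Z \<equiv> s * (m / (t - m)) + B / (t - B)"
  shows "(\<Sum>p\<in>P. x p / (t - x p)) \<le> Z"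
    and "(\<Sum>p\<in>P. x p / (t - x p)) = Z \<Longrightarrow> card P = s + 1 \<and> (\<forall>p\<in>P. x p = m \<or> x p = B)"
    and "p \<in> P \<Longrightarrow> x p < t"
proof -
  \<comment> \<open>The at least \<open>s\<close> other parts take up at least \<open>s * m\<close>
    of the total \<open>N\<close>.\<close>
  have le_B: "x p \<le> B" if "p \<in> P" for p
  proof -
    have "s * m \<le> (card P - 1) * m"
      using assms by (intro mult_right_mono) auto
    also have "\<dots> = (\<Sum>q\<in>P - {p}. m)"
      using that assms by simp
    also have "\<dots> \<le> sum x (P - {p})"
      by (intro sum_mono m) auto
    also have "\<dots> = N - x p"
      using that assms by (simp add: sum_diff1)
    finally show ?thesis using B by simp
  qed
  then show "p \<in> P \<Longrightarrow> x p < t"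
    using t by fastforce
  obtain p0 where p0: "p0 \<in> P"
    using \<open>s < card P\<close> by fastforce
  have mB: "m \<le> B" using m[OF p0] le_B[OF p0] by simp
  have "m < t" "0 < B" "0 < t" using mB t \<open>m > 0\<close> by linarith+
  define D where "D = (t - m) * (t - B)"
  have D: "D > 0" using \<open>m < t\<close> t by (simp add: D_def)
  \<comment> \<open>\<open>e p\<close> is the gap between chord and function at \<open>x p\<close>,
    factored so that its sign and its zeros \<open>m\<close> and \<open>B\<close> are
    visible.\<close>
  define e where "e p = t * ((x p - m) * (B - x p)) / ((t - x p) * D)" for p
  have e0: "e p \<ge> 0" if "p \<in> P" for p
    unfolding e_def using m[OF that] le_B[OF that] D t \<open>0 < t\<close>
    by (intro divide_nonneg_pos mult_nonneg_nonneg mult_pos_pos) auto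
  have chord: "x p / (t - x p) = (t * x p - m * B) / D - e p" if "p \<in> P" for p
  proof -
    have "t - x p > 0" using le_B[OF that] t by simp
    have "x p * D = (t * x p - m * B) * (t - x p) - t * ((x p - m) * (B - x p))"
      unfolding D_def by (simp add: algebra_simps)
    then show ?thesis
      unfolding e_def using D \<open>t - x p > 0\<close> by (simp add: divide_simps)
  qed
  have "(\<Sum>p\<in>P. x p / (t - x p)) = (\<Sum>p\<in>P. (t * x p - m * B) / D) - sum e P"
    by (simp add: chord sum_subtractf)
  also have "(\<Sum>p\<in>P. (t * x p - m * B) / D) = (t * N - card P * (m * B)) / D"
    by (simp add: sum_divide_distrib[symmetric] sum_subtractf sum_distrib_left[symmetric] sum)
  \<comment> \<open>\<open>s\<close> values \<open>m\<close> and one value \<open>B\<close> have sum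
    \<open>N\<close> and give exactly \<open>Z\<close>; each part beyond \<open>s + 1\<close> costs
    \<open>m * B / D\<close>.\<close>
  also have "\<dots> = Z - (card P - (s + 1)) * (m * B) / D"
  proof -
    have "Z = (s * m * (t - B) + B * (t - m)) / D"
      unfolding Z_def D_def using \<open>m < t\<close> t by (simp add: divide_simps)
    also have "s * m * (t - B) + B * (t - m) = t * N - (s + 1) * (m * B)"
      unfolding B by (simp add: algebra_simps)
    finally show ?thesis
      using \<open>s < card P\<close> by (simp add: diff_divide_distrib[symmetric] of_nat_diff algebra_simps)
  qed
  finally have eq: "(\<Sum>p\<in>P. x p / (t - x p)) = Z - (card P - (s + 1)) * (m * B) / D - sum e P" .
  have c0: "(card P - (s + 1)) * (m * B) / D \<ge> 0"
    using D \<open>m > 0\<close> \<open>0 < B\<close> by simp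
  have s0: "sum e P \<ge> 0" using e0 by (rule sum_nonneg)
  show "(\<Sum>p\<in>P. x p / (t - x p)) \<le> Z" using eq c0 s0 by simp
  assume "(\<Sum>p\<in>P. x p / (t - x p)) = Z"
  then have "(card P - (s + 1)) * (m * B) / D = 0" and "sum e P = 0"
    using eq c0 s0 by linarith+
  then have "card P = s + 1" and "\<forall>p\<in>P. e p = 0"
    using D \<open>m > 0\<close> \<open>0 < B\<close> \<open>s < card P\<close> e0 \<open>finite P\<close> by (auto simp: sum_nonneg_eq_0_iff)
  moreover have "x p = m \<or> x p = B" if "p \<in> P" "e p = 0" for p
    using that le_B[OF that(1)] t D \<open>0 < t\<close> by (auto simp: e_def)
  ultimately show "card P = s + 1 \<and> (\<forall>p\<in>P. x p = m \<or> x p = B)"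
    by blast
qed

section \<open>The parameter \<open>t\<close> and the inequalities for each cut size\<close>

text \<open>The cubic is the eigenvalue equation for \<open>t - 1\<close> with weights constant on
  the three vertex classes of the extremal graph. The difference of its sides is
  \<open>- \<delta>^3\<close> at \<open>n - \<delta>\<close> and
  \<open>\<delta> (n (n - 1) - 2 \<delta>^2) > 0\<close> at \<open>n\<close>.\<close>

lemma extremal_root_exists:
  fixes n \<delta> :: real
  assumes "\<delta> \<ge> 2" "n \<ge> 5 * \<delta>"
  obtains t where "n - \<delta> < t" "t < n"
    "(t - n + \<delta>) * (t * (t - 1)) = \<delta>\<^sup>2 * (t - n + 2 * \<delta>)"
proof -
  define p where "p t = (t - n + \<delta>) * (t * (t - 1)) - \<delta>\<^sup>2 * (t - n + 2 * \<delta>)" for t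
  have lo: "p (n - \<delta>) < 0"
    using assms by (simp add: p_def)
  have "2 * \<delta>\<^sup>2 < n * (n - 1)"
  proof -
    have "2 * \<delta>\<^sup>2 < (5 * \<delta>) * (5 * \<delta> - 1)"
      using assms mult_mono[of 2 \<delta> \<delta> \<delta>] by (simp add: power2_eq_square algebra_simps)
    also have "\<dots> \<le> n * (n - 1)"
      using assms by (intro mult_mono) auto
    finally show ?thesis .
  qed
  then have "\<delta> * (2 * \<delta>\<^sup>2) < \<delta> * (n * (n - 1))"
    using assms by (intro mult_strict_left_mono) auto
  then have hi: "p n > 0"
    by (simp add: p_def algebra_simps)
  have "\<exists>t\<ge>n - \<delta>. t \<le> n \<and> p t = 0"
    using lo hi assms unfolding p_def
    by (intro IVT') (auto intro!: continuous_intros)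
  then obtain t where "n - \<delta> \<le> t" "t \<le> n" "p t = 0" by blast
  moreover have "t \<noteq> n - \<delta>" "t \<noteq> n" using lo hi \<open>p t = 0\<close> by auto
  ultimately show ?thesis using that[of t] by (simp add: p_def)
qed

text \<open>With \<open>\<epsilon> = t - n + \<delta>\<close> and \<open>\<eta> = t - n + s m\<close>, the weight is a strict supersolution iff
  \<open>s\<^sup>2 m (s + \<eta>) < \<eta> t (t - m)\<close>. The next three lemmas are the cases \<open>s > \<delta>\<close>, \<open>s = 1\<close>
  and \<open>2 \<le> s < \<delta> = s + j\<close>.\<close>

lemma large_cut_inequality:
  fixes t \<delta> s n \<epsilon> :: real
  assumes \<delta>: "\<delta> \<ge> 2" "n \<ge> 5 * \<delta>" and s: "s > \<delta>" "n \<ge> 2 * s + 1"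
    and \<epsilon>: "\<epsilon> > 0" "t = n - \<delta> + \<epsilon>" and root: "\<epsilon> * (t * (t - 1)) = \<delta>\<^sup>2 * (\<delta> + \<epsilon>)"
  shows "s\<^sup>2 * (s + (\<epsilon> + s - \<delta>)) < (\<epsilon> + s - \<delta>) * (t * (t - 1))"
proof -
  \<comment> \<open>Subtracting \<open>root\<close> from the claim and dividing by
    \<open>s - \<delta>\<close> leaves
    \<open>(s + \<delta>) (\<delta> + \<epsilon>) + 2 s^2 < t (t - 1)\<close>. Its left side
    increases with \<open>s\<close>, so it is estimated at \<open>s = (n - 1) / 2\<close>.\<close>
  have "2 * s\<^sup>2 \<le> 2 * ((n - 1) / 2)\<^sup>2"
    using s \<delta> by (intro mult_left_mono power_mono) auto
  moreover have "(s + \<delta>) * (\<delta> + \<epsilon>) \<le> ((n - 1) / 2 + \<delta>) * (\<delta> + \<epsilon>)"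
    using s \<delta> \<epsilon> by (intro mult_right_mono) auto
  moreover have "2 * ((n - 1) / 2)\<^sup>2 + ((n - 1) / 2 + \<delta>) * (\<delta> + \<epsilon>) < t * (t - 1)"
  proof -
    have "t * (t - 1) - 2 * ((n - 1) / 2)\<^sup>2 - ((n - 1) / 2 + \<delta>) * (\<delta> + \<epsilon>)
        = n * (n - 5 * \<delta>) / 2 + (3 * \<delta> - 1) / 2 + \<epsilon> * ((3 * n - 6 * \<delta> - 1) / 2) + \<epsilon>\<^sup>2"
      unfolding \<epsilon>(2) by (simp add: power2_eq_square field_simps)
    moreover have "n * (n - 5 * \<delta>) / 2 \<ge> 0" "\<epsilon> * ((3 * n - 6 * \<delta> - 1) / 2) \<ge> 0"
      using \<delta> \<epsilon> by auto
    ultimately show ?thesis using \<delta> zero_le_power2[of \<epsilon>] by argo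
  qed
  ultimately have "(s + \<delta>) * (\<delta> + \<epsilon>) + 2 * s\<^sup>2 < t * (t - 1)"
    by linarith
  then have "(s - \<delta>) * ((s + \<delta>) * (\<delta> + \<epsilon>) + 2 * s\<^sup>2) < (s - \<delta>) * (t * (t - 1))"
    using s by (intro mult_strict_left_mono) auto
  moreover have "(s - \<delta>) * ((s + \<delta>) * (\<delta> + \<epsilon>) + 2 * s\<^sup>2) + \<delta>\<^sup>2 * (\<delta> + \<epsilon>)
      = s\<^sup>2 * (s + (\<epsilon> + s - \<delta>))"
    by (simp add: power2_eq_square algebra_simps)
  ultimately show ?thesis
    using root by (simp add: algebra_simps)
qed

lemma cut_vertex_inequality:
  fixes t \<delta> \<epsilon> :: real
  assumes \<delta>: "\<delta> \<ge> 2" and t: "t > \<delta> + 1" and \<epsilon>: "\<epsilon> > 0"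
    and root: "\<epsilon> * (t * (t - 1)) = \<delta>\<^sup>2 * (\<delta> + \<epsilon>)"
  shows "\<delta> * (1 + \<epsilon>) < \<epsilon> * (t * (t - \<delta>))"
proof -
  \<comment> \<open>Multiplying the claim by \<open>t - 1\<close> lets \<open>root\<close> replace
    \<open>\<epsilon> t (t - 1)\<close>; after division by \<open>\<delta>\<close> this inequality
    remains, and it holds factor by factor.\<close>
  have "(1 + \<epsilon>) * (t - 1) < (\<delta> + \<epsilon>) * (\<delta> * (t - \<delta>))"
  proof (rule mult_strict_mono)
    have "0 < (\<delta> - 1) * (t - (\<delta> + 1))" using \<delta> t by simp
    then show "t - 1 < \<delta> * (t - \<delta>)" by (simp add: algebra_simps)
  qed (use \<delta> t \<epsilon> in auto)
  then have "\<delta> * ((1 + \<epsilon>) * (t - 1)) < \<delta> * ((\<delta> + \<epsilon>) * (\<delta> * (t - \<delta>)))"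
    using \<delta> by (intro mult_strict_left_mono) auto
  also have "\<dots> = (\<delta>\<^sup>2 * (\<delta> + \<epsilon>)) * (t - \<delta>)"
    by (simp add: power2_eq_square)
  also have "\<dots> = \<epsilon> * (t * (t - \<delta>)) * (t - 1)"
    unfolding root[symmetric] by simp
  finally have "\<delta> * (1 + \<epsilon>) * (t - 1) < \<epsilon> * (t * (t - \<delta>)) * (t - 1)"
    by (simp add: mult.assoc)
  then show ?thesis using \<delta> t by simp
qed

lemma small_cut_inequality:
  fixes t s j n \<epsilon> :: real
  defines "\<delta> \<equiv> s + j"
  assumes s: "s \<ge> 2" and j: "j \<ge> 1" and n: "n \<ge> 5 * \<delta>" "n \<ge> 2 / 5 * \<delta>\<^sup>2 + \<delta>"
    and \<epsilon>: "\<epsilon> > 0" "t = n - \<delta> + \<epsilon>"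
  shows "s\<^sup>2 * (j + 1) * (s + (\<epsilon> + (s - 1) * j)) < (\<epsilon> + (s - 1) * j) * (t * (t - (j + 1)))"
proof -
  define T where "T = t * (t - (j + 1))"
  have \<delta>: "\<delta> \<ge> 3" "s \<le> \<delta>" "j \<le> \<delta>" using s j by (auto simp: \<delta>_def)
  have t: "t \<ge> 4 * \<delta>" "t \<ge> 2 / 5 * \<delta>\<^sup>2" using n \<epsilon> by auto
  have T: "T \<ge> 3 / 4 * t\<^sup>2"
  proof -
    have "t - (j + 1) \<ge> 3 / 4 * t" using t(1) s unfolding \<delta>_def by argo
    then have "t * (3 / 4 * t) \<le> T" unfolding T_def using t \<delta> by (intro mult_left_mono) auto
    then show ?thesis by (simp add: power2_eq_square)
  qed
  \<comment> \<open>Two lower bounds for \<open>T\<close>, one quadratic and one cubic in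
    \<open>\<delta>\<close>: the first absorbs \<open>5 s^2\<close>, the second
    \<open>j s^2\<close>. The cubic one uses
    \<open>n \<ge> 2 / 5 * \<delta>\<^sup>2 + \<delta>\<close>.\<close>
  have T1: "T \<ge> 12 * \<delta>\<^sup>2"
    using T power_mono[OF t(1), of 2] \<delta> by (simp add: power_mult_distrib)
  have T2: "T \<ge> 6 / 5 * \<delta> ^ 3"
  proof -
    have "(4 * \<delta>) * (2 / 5 * \<delta>\<^sup>2) \<le> t * t" using t \<delta> by (intro mult_mono) auto
    then show ?thesis using T by (simp add: power2_eq_square power3_eq_cube)
  qed
  \<comment> \<open>The inequality \<open>4 j s \<le> (s + j)^2\<close> bounds the product
    \<open>j s\<close>.\<close>
  have "j * s\<^sup>2 \<le> \<delta> ^ 3 / 4"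
  proof -
    have "4 * (j * s) \<le> \<delta>\<^sup>2"
      using zero_le_power2[of "s - j"] by (simp add: \<delta>_def power2_eq_square algebra_simps)
    then have "s * (4 * (j * s)) \<le> \<delta> * \<delta>\<^sup>2"
      using s j \<delta> by (intro mult_mono) auto
    then show ?thesis by (simp add: power2_eq_square power3_eq_cube mult_ac)
  qed
  moreover have "s\<^sup>2 \<le> \<delta>\<^sup>2" using s \<delta> by (intro power_mono) auto
  moreover have "\<delta> ^ 3 > 0" using \<delta> by simp
  ultimately have bound: "(j + 5) * s\<^sup>2 < T"
    using T1 T2 unfolding distrib_right by argo
  \<comment> \<open>With \<open>\<eta> = \<epsilon> + (s - 1) j\<close> the claim reads
    \<open>s^2 (j + 1) s < \<eta> (T - s^2 (j + 1))\<close>. Lowering \<open>T\<close> to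
    \<open>(j + 5) s^2\<close> leaves the factor \<open>4 s^2\<close>, and
    \<open>(j + 1) s \<le> 4 (s - 1) j\<close> since \<open>j \<ge> 1\<close> and
    \<open>s \<ge> 2\<close>.\<close>
  have "s\<^sup>2 * (j + 1) * s \<le> (s - 1) * j * ((j + 5) * s\<^sup>2 - s\<^sup>2 * (j + 1))"
  proof -
    have "(j + 1) * s \<le> 4 * ((s - 1) * j)"
    proof -
      have "(j + 1) * s \<le> (2 * j) * (2 * (s - 1))"
        using s j by (intro mult_mono) auto
      then show ?thesis by (simp add: algebra_simps)
    qed
    then have "s\<^sup>2 * ((j + 1) * s) \<le> s\<^sup>2 * (4 * ((s - 1) * j))"
      by (intro mult_left_mono) auto
    then show ?thesis by (simp add: algebra_simps)
  qed
  also have "\<dots> < (s - 1) * j * (T - s\<^sup>2 * (j + 1))"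
    using s j bound by (intro mult_strict_left_mono) auto
  also have "\<dots> \<le> (\<epsilon> + (s - 1) * j) * (T - s\<^sup>2 * (j + 1))"
  proof (rule mult_right_mono)
    have "s\<^sup>2 * (j + 1) \<le> s\<^sup>2 * (j + 5)" using s by (intro mult_left_mono) auto
    then show "0 \<le> T - s\<^sup>2 * (j + 1)" using bound by (simp add: mult.commute)
  qed (use \<epsilon> in simp)
  finally show ?thesis unfolding T_def[symmetric] by (simp add: algebra_simps)
qed

text \<open>Clearing denominators: with \<open>t - B = s + \<eta>\<close> the right side minus the
  left is a fraction with positive denominator whose numerator is the difference in the polynomial
  inequality.\<close>

lemma cut_sum_bound_iff:
  fixes s m t B :: real
  assumes "0 < s" "m < t" "B < t" "0 < t" and \<eta>: "\<eta> = t - B - s"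
  shows "s * (m / (t - m)) + B / (t - B) \<le> (t - s) / s \<longleftrightarrow> s\<^sup>2 * m * (s + \<eta>) \<le> \<eta> * (t * (t - m))"
    and "s * (m / (t - m)) + B / (t - B) < (t - s) / s \<longleftrightarrow> s\<^sup>2 * m * (s + \<eta>) < \<eta> * (t * (t - m))"
proof -
  have pos: "s + \<eta> > 0" "t - m > 0" using assms by auto
  have "(t - s) / s - (s * (m / (t - m)) + B / (t - B))
      = (\<eta> * (t * (t - m)) - s\<^sup>2 * m * (s + \<eta>)) / (s * (s + \<eta>) * (t - m))"
  proof -
    have B: "B = t - (s + \<eta>)" using \<eta> by simp
    show ?thesis
      unfolding B using pos \<open>0 < s\<close> by (simp add: divide_simps) (simp add: power2_eq_square algebra_simps)
  qed
  moreover have "s * (s + \<eta>) * (t - m) > 0" using pos \<open>0 < s\<close> by simp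
  ultimately have "0 \<le> (t - s) / s - (s * (m / (t - m)) + B / (t - B))
        \<longleftrightarrow> 0 \<le> \<eta> * (t * (t - m)) - s\<^sup>2 * m * (s + \<eta>)"
      "0 < (t - s) / s - (s * (m / (t - m)) + B / (t - B))
        \<longleftrightarrow> 0 < \<eta> * (t * (t - m)) - s\<^sup>2 * m * (s + \<eta>)"
    by (simp_all only: zero_le_divide_iff zero_less_divide_iff) auto
  then show "s * (m / (t - m)) + B / (t - B) \<le> (t - s) / s
        \<longleftrightarrow> s\<^sup>2 * m * (s + \<eta>) \<le> \<eta> * (t * (t - m))"
      "s * (m / (t - m)) + B / (t - B) < (t - s) / s \<longleftrightarrow> s\<^sup>2 * m * (s + \<eta>) < \<eta> * (t * (t - m))"
    by simp_all
qed

text \<open>At \<open>s = \<delta>\<close> one has \<open>m = 1\<close> and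
  \<open>\<eta> = \<epsilon>\<close>, and the cleared inequality is \<open>root\<close>, an
  equality. For every other \<open>s\<close> the three preceding cases make it strict.\<close>

lemma cut_sum_bound:
  fixes n \<delta> s :: nat and t m B :: real
  defines "m \<equiv> max 1 (real \<delta> + 1 - real s)"
  defines "B \<equiv> real n - s - s * m"
  assumes \<delta>: "\<delta> \<ge> 2" and n: "real n \<ge> max (5 * real \<delta>) (2 / 5 * (real \<delta>)\<^sup>2 + real \<delta>)"
    and s: "s \<ge> 1" "n \<ge> 2 * s + 1" and t: "real n - real \<delta> < t" "t < real n"
    and root: "(t - real n + real \<delta>) * (t * (t - 1)) = (real \<delta>)\<^sup>2 * (t - real n + 2 * real \<delta>)"
  shows "B < t" and "s * (m / (t - m)) + B / (t - B) \<le> (t - s) / s"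
    and "s * (m / (t - m)) + B / (t - B) = (t - s) / s \<Longrightarrow> s = \<delta>"
proof -
  define \<epsilon> where "\<epsilon> = t - n + \<delta>"
  have \<epsilon>: "\<epsilon> > 0" "t = real n - real \<delta> + \<epsilon>" using t by (auto simp: \<epsilon>_def)
  have root': "\<epsilon> * (t * (t - 1)) = (real \<delta>)\<^sup>2 * (\<delta> + \<epsilon>)"
    using root by (simp add: \<epsilon>_def algebra_simps)
  have t4: "t > 4 * real \<delta>" using n t by simp
  define \<eta> where "\<eta> = t - B - s"
  have \<eta>: "\<eta> = \<epsilon> + s * m - \<delta>" by (simp add: \<eta>_def B_def \<epsilon>_def)
  have "\<eta> > 0 \<and> s\<^sup>2 * m * (s + \<eta>) \<le> \<eta> * (t * (t - m)) \<and>
      (s \<noteq> \<delta> \<longrightarrow> s\<^sup>2 * m * (s + \<eta>) < \<eta> * (t * (t - m)))"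
  proof (cases "s = \<delta>")
    case True
    then have "m = 1" by (simp add: m_def)
    then show ?thesis using True root' \<epsilon> by (simp add: \<eta>)
  next
    case False
    consider "s > \<delta>" | "s = 1" | "s \<ge> 2" "s < \<delta>" using False s by linarith
    then have "\<eta> > 0 \<and> s\<^sup>2 * m * (s + \<eta>) < \<eta> * (t * (t - m))"
    proof cases
      case 1
      then have m: "m = 1" by (simp add: m_def)
      have "(real s)\<^sup>2 * (s + (\<epsilon> + s - \<delta>)) < (\<epsilon> + s - \<delta>) * (t * (t - 1))"
        using \<delta> n 1 s \<epsilon> root' by (intro large_cut_inequality[where n = n]) auto
      then show ?thesis using 1 \<epsilon> by (simp add: \<eta> m)
    next
      case 2
      then have m: "m = \<delta>" using \<delta> by (simp add: m_def)
      have "\<delta> * (1 + \<epsilon>) < \<epsilon> * (t * (t - \<delta>))"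
        using \<delta> t4 \<epsilon> root' by (intro cut_vertex_inequality) auto
      then show ?thesis using 2 \<epsilon> by (simp add: \<eta> m)
    next
      case 3
      define j where "j = real \<delta> - s"
      have j: "j \<ge> 1" "real \<delta> = s + j" using 3 by (auto simp: j_def)
      have m: "m = j + 1" using 3 by (simp add: m_def j_def)
      have \<eta>': "\<eta> = \<epsilon> + (s - 1) * j" using s by (simp add: \<eta> m j algebra_simps of_nat_diff)
      have "(real s)\<^sup>2 * (j + 1) * (s + (\<epsilon> + (real s - 1) * j))
          < (\<epsilon> + (real s - 1) * j) * (t * (t - (j + 1)))"
        using 3 j n \<epsilon> by (intro small_cut_inequality[where n = n]) auto
      moreover have "(real s - 1) * j \<ge> 0" using s j by simp
      ultimately show ?thesis using \<epsilon>(1) s unfolding \<eta>' m by (simp add: of_nat_diff)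
    qed
    then show ?thesis by simp
  qed
  then have *: "\<eta> > 0" "s\<^sup>2 * m * (s + \<eta>) \<le> \<eta> * (t * (t - m))"
    "s \<noteq> \<delta> \<Longrightarrow> s\<^sup>2 * m * (s + \<eta>) < \<eta> * (t * (t - m))" by auto
  show "B < t" using \<open>\<eta> > 0\<close> by (simp add: \<eta>_def)
  have "m < t" "0 < t" using \<delta> t4 by (auto simp: m_def)
  note iff = cut_sum_bound_iff[OF _ \<open>m < t\<close> \<open>B < t\<close> \<open>0 < t\<close> \<eta>_def]
  show "s * (m / (t - m)) + B / (t - B) \<le> (t - s) / s"
    using iff(1) s *(2) by simp
  show "s = \<delta>" if "s * (m / (t - m)) + B / (t - B) = (t - s) / s"
    using iff(2) s *(3) that by fastforce
qed

section \<open>The eigenvalue \<open>t - 1\<close> of the extremal graph\<close>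

lemma extremal_graph_eigenfunction:
  fixes t :: real
  assumes d: "d \<ge> 1" and n: "n > 2 * d" and t: "t > 1" "t - real n + 2 * real d > 0"
    and root: "(t - real n + real d) * (t * (t - 1)) = (real d)\<^sup>2 * (t - real n + 2 * real d)"
  shows "\<exists>f. eigenfunction (extremal_graph n d) (t - 1) f"
proof -
  define q where "q = t - real n + 2 * real d"
  \<comment> \<open>With weight 1 on the join factor, the equations at a clique vertex and at an
    isolated vertex force \<open>b\<close> and \<open>c\<close>; \<open>q\<close> is
    \<open>t\<close> minus the clique size.\<close>
  define b c where "b = d / q" and "c = d / (t - 1)"
  define f :: "nat + nat + nat \<times> nat \<Rightarrow> real"
    where "f = case_sum (\<lambda>_. 1) (case_sum (\<lambda>_ :: nat. b) (\<lambda>_ :: nat \<times> nat. c))"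
  have q: "q > 0" "real (n - 2 * d) = t - q" using t n by (auto simp: q_def of_nat_diff)
  have neq: "(\<Sum>j<m. if i \<noteq> j then x else 0) = (real m - 1) * x" if "i < m" for i m :: nat and x :: real
  proof -
    have "(\<Sum>j<m. if i \<noteq> j then x else 0) = (\<Sum>j\<in>{..<m} - {i}. x)"
      by (rule sum.mono_neutral_cong_right) auto
    then show ?thesis using that by (simp add: of_nat_diff)
  qed
  \<comment> \<open>Dividing \<open>root\<close> by \<open>q * (t - 1)\<close> yields the remaining
    equation, the one at a vertex of the join factor.\<close>
  have "(t * d) * (t - 1) + (real d)\<^sup>2 * q = t * q * (t - 1)"
    using root by (simp add: q_def algebra_simps)
  then have eq: "t * d / q + (real d)\<^sup>2 / (t - 1) = t"
    using q t by (simp add: divide_simps mult_ac)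
  have "(\<Sum>v\<in>pverts (extremal_graph n d). if (u, v) \<in> parcs (extremal_graph n d) then f v else 0)
      = (t - 1) * f u" if u: "u \<in> pverts (extremal_graph n d)" for u
  proof -
    consider (join) i where "u = Inl i" "i < d" | (clique) i where "u = Inr (Inl i)" "i < n - 2 * d"
      | (isolated) i where "u = Inr (Inr (i, 0))" "i < d"
      using u unfolding pverts_extremal_graph by blast
    then show ?thesis
    proof cases
      case join
      have "(t - q) * b = t * d / q - d"
        using q by (simp add: b_def divide_simps) (simp add: algebra_simps)
      then have "real d - 1 + ((t - q) * b + d * c) = t - 1"
        using eq by (simp add: c_def power2_eq_square)
      then show ?thesis
        using join q neq[OF join(2), of 1]
        unfolding sum_pverts_extremal_graph
        by (simp add: parcs_extremal_graph pverts_extremal_graph f_def image_iff cong: if_cong)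
    next
      case clique
      have "d + (real (n - 2 * d) - 1) * b = (t - 1) * b"
        using q unfolding q(2) b_def by (simp add: divide_simps) (simp add: algebra_simps)
      then show ?thesis
        using clique neq[OF clique(2), of b]
        unfolding sum_pverts_extremal_graph
        by (simp add: parcs_extremal_graph pverts_extremal_graph f_def image_iff cong: if_cong)
    next
      case isolated
      then show ?thesis
        using t unfolding sum_pverts_extremal_graph
        by (simp add: parcs_extremal_graph pverts_extremal_graph f_def c_def image_iff cong: if_cong)
    qed
  qed
  moreover have "Inl 0 \<in> pverts (extremal_graph n d)" "f (Inl 0) \<noteq> 0"
    using d by (auto simp: pverts_extremal_graph f_def)
  ultimately have "eigenfunction (extremal_graph n d) (t - 1) f"
    unfolding eigenfunction_def by blast
  then show ?thesis by blast
qed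

section \<open>Component sizes and the weight of a cut\<close>

text \<open>A vertex \<open>v\<close> of \<open>X\<close> has all its neighbours in \<open>S\<close>
  or in \<open>X - {v}\<close>, and there are at least \<open>min_degree G\<close> of them.\<close>

lemma degree_le_part_size:
  assumes "pair_graph G" and "S \<subseteq> pverts G" and "X \<subseteq> pverts G - S" "X \<noteq> {}"
    and closed: "\<And>u v. u \<in> X \<Longrightarrow> v \<in> pverts G - S \<Longrightarrow> (u, v) \<in> parcs G \<Longrightarrow> v \<in> X"
  shows "min_degree G + 1 \<le> card S + card X"
proof -
  interpret pair_graph G by fact
  have fin: "finite S" "finite X"
    using assms pair_finite_verts by (auto intro: finite_subset)
  obtain v where v: "v \<in> X" using \<open>X \<noteq> {}\<close> by blast
  have "min_degree G \<le> out_degree (with_proj G) v"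
    unfolding min_degree_def using v assms pair_finite_verts by (intro Min_le) auto
  also have "\<dots> = card (snd ` out_arcs (with_proj G) v)"
    unfolding out_degree_def by (rule card_image[symmetric]) (auto simp: inj_on_def)
  also have "\<dots> \<le> card (S \<union> (X - {v}))"
  proof (rule card_mono)
    show "snd ` out_arcs (with_proj G) v \<subseteq> S \<union> (X - {v})"
      using v closed wellformed' no_loops' by fastforce
  qed (use fin in auto)
  also have "\<dots> \<le> card S + (card X - 1)"
    using card_Un_le[of S "X - {v}"] v fin by simp
  finally have "min_degree G \<le> card S + (card X - 1)" .
  moreover have "card X > 0" using v fin by (auto simp: card_gt_0_iff)
  ultimately show ?thesis by linarith
qed

text \<open>The weight is \<open>1\<close> on the cut and \<open>card S / (t - card X)\<close> on a part \<open>X\<close>; on the parts it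
  is chosen such that the eigenvalue equation for \<open>t - 1\<close> holds in the graph with all possible arcs.\<close>

lemma cut_weight_exists:
  fixes G :: "'a pair_pre_digraph" and t :: real
  defines "y_sum y u \<equiv> \<Sum>v\<in>pverts G. if (u, v) \<in> parcs G then y v else (0 :: real)"
  assumes "pair_graph G" and S: "S \<subseteq> pverts G" "S \<noteq> {}"
    and P: "finite P" "\<Union>P = pverts G - S" "disjoint P"
    and closed: "\<forall>X\<in>P. \<forall>u\<in>X. \<forall>v\<in>pverts G - S. (u, v) \<in> parcs G \<longrightarrow> v \<in> X"
    and less_t: "\<forall>X\<in>P. card X < t"
    and le: "(\<Sum>X\<in>P. card X / (t - card X)) \<le> (t - card S) / card S"
  obtains y where "\<forall>v\<in>pverts G. 0 < y v"
    and "\<forall>u\<in>pverts G. y_sum y u \<le> (t - 1) * y u"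
    and "(\<forall>u\<in>pverts G. y_sum y u = (t - 1) * y u) \<longrightarrow>
      (\<Sum>X\<in>P. card X / (t - card X)) = (t - card S) / card S \<and>
      (\<forall>u\<in>pverts G. \<forall>v\<in>pverts G. (u, v) \<in> parcs G \<longleftrightarrow>
        u \<noteq> v \<and> (u \<in> S \<or> v \<in> S \<or> (\<exists>X\<in>P. u \<in> X \<and> v \<in> X)))"
proof -
  interpret pair_graph G by fact
  let ?V = "pverts G"
  have finS: "finite S" and finP: "X \<in> P \<Longrightarrow> finite X" for X
    using S P pair_finite_verts by (auto intro: finite_subset)
  have t: "card X < t" if "X \<in> P" for X using less_t that by blast
  define s where "s = real (card S)"
  have s: "s > 0" using S finS by (simp add: s_def card_gt_0_iff)
  have "\<forall>v\<in>?V - S. \<exists>X\<in>P. v \<in> X" using P by blast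
  then obtain C where C: "\<And>v. v \<in> ?V - S \<Longrightarrow> C v \<in> P \<and> v \<in> C v" by metis
  have C_eq: "C v = X" if "X \<in> P" "v \<in> X" for X v
    using C[of v] P that by (auto simp: disjoint_def)
  define y where "y v = (if v \<in> S then 1 else s / (t - card (C v)))" for v
  have y_part: "y v = s / (t - card X)" if "X \<in> P" "v \<in> X" for X v
    using P that C_eq[OF that] by (auto simp: y_def)
  have pos: "0 < y v" if "v \<in> ?V" for v
    using s t C[of v] that by (auto simp: y_def)
  \<comment> \<open>\<open>Q u\<close> is the closed neighbourhood of \<open>u\<close> in the graph
    with all possible arcs: the cut is joined to everything and the parts are cliques.\<close>
  define Q where "Q u = (if u \<in> S then ?V else S \<union> C u)" for u
  have uQ: "u \<in> Q u" and QV: "Q u \<subseteq> ?V" if "u \<in> ?V" for u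
    using C[of u] S P that by (auto simp: Q_def)
  have sum_part: "sum y X = card X * (s / (t - card X))" if "X \<in> P" for X
    using y_part[OF that] by simp
  have sum_S: "sum y S = s" by (simp add: y_def s_def)
  have sum_V: "sum y ?V = s + s * (\<Sum>X\<in>P. card X / (t - card X))"
  proof -
    have "sum y ?V = sum y (?V - S) + sum y S"
      using S pair_finite_verts by (simp add: sum.subset_diff)
    also have "sum y (?V - S) = (\<Sum>X\<in>P. sum y X)"
      unfolding P(2)[symmetric] using finP P(3) by (subst sum.Union_disjoint) (auto simp: disjoint_def)
    finally show ?thesis by (simp add: sum_part sum_S sum_distrib_left mult_ac)
  qed
  \<comment> \<open>On a part this is an equality by the choice of the weight; on the cut it is the
    hypothesis \<open>le\<close>.\<close>
  have sum_Q: "sum y (Q u) \<le> t * y u" if u: "u \<in> ?V" for u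
  proof (cases "u \<in> S")
    case True
    then have "y u = 1" "Q u = ?V" by (auto simp: y_def Q_def)
    then show ?thesis
      using le s by (simp add: sum_V pos_le_divide_eq mult.commute s_def[symmetric])
  next
    case False
    then have CP: "C u \<in> P" "u \<in> C u" using C u by auto
    have "S \<inter> C u = {}" using CP P by blast
    then have "sum y (Q u) = s + card (C u) * (s / (t - card (C u)))"
      using False finS finP CP by (simp add: Q_def sum.union_disjoint sum_S sum_part)
    also have "\<dots> = t * y u"
      using False t[OF CP(1)] by (simp add: y_def divide_simps) (simp add: algebra_simps)
    finally show ?thesis by simp
  qed
  define N where "N u = {v \<in> ?V. (u, v) \<in> parcs G}" for u
  have y_sum: "y_sum y u = sum y (N u)" for u
    unfolding y_sum_def N_def using pair_finite_verts by (simp add: sum.inter_filter)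
  have NQ: "N u \<subseteq> Q u - {u}" if "u \<in> ?V" for u
    using C[of u] closed that no_loops'[of u u] by (auto simp: N_def Q_def)
  have sum_Q': "sum y (Q u - {u}) = sum y (Q u) - y u" if "u \<in> ?V" for u
    using uQ[OF that] QV[OF that] pair_finite_verts by (simp add: sum_diff1 finite_subset)
  have finQ: "finite (Q u - {u})" if "u \<in> ?V" for u
    using QV[OF that] pair_finite_verts by (meson finite_Diff finite_subset)
  have pos_Q: "0 < y v" if "u \<in> ?V" "v \<in> Q u - {u}" for u v
    using pos QV[OF that(1)] that(2) by blast
  have sum_N: "sum y (N u) \<le> sum y (Q u - {u})" if "u \<in> ?V" for u
    using finQ[OF that] NQ[OF that] pos_Q[OF that] by (intro sum_mono2) (auto intro: less_imp_le)
  show ?thesis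
  proof (rule that; (intro impI)?)
    show "\<forall>v\<in>?V. 0 < y v" using pos by blast
    show "\<forall>u\<in>?V. y_sum y u \<le> (t - 1) * y u"
    proof
      fix u assume "u \<in> ?V"
      then show "y_sum y u \<le> (t - 1) * y u"
        using sum_N[of u] sum_Q'[of u] sum_Q[of u] y_sum by (simp add: left_diff_distrib)
    qed
  next
    assume "\<forall>u\<in>?V. y_sum y u = (t - 1) * y u"
    then have eqN: "sum y (N u) = sum y (Q u - {u})" and eqQ: "sum y (Q u) = t * y u"
      if "u \<in> ?V" for u
      using sum_N[OF that] sum_Q'[OF that] sum_Q[OF that] y_sum that by (fastforce simp: left_diff_distrib)+
    \<comment> \<open>At a cut vertex \<open>Q u\<close> is the whole vertex set, so equality there
      determines the sum over the parts.\<close>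
    obtain u where u: "u \<in> S" using S by blast
    then have "y u = 1" "Q u = ?V" by (auto simp: y_def Q_def)
    then have "s + s * (\<Sum>X\<in>P. card X / (t - card X)) = t"
      using eqQ[of u] u S sum_V by auto
    then have "(\<Sum>X\<in>P. card X / (t - card X)) = (t - card S) / card S"
      using s unfolding s_def by (simp add: divide_simps algebra_simps)
    \<comment> \<open>Weights are positive, so a missing arc would make the sum over the neighbours
      strictly smaller.\<close>
    moreover have "N u = Q u - {u}" if u: "u \<in> ?V" for u
    proof (rule ccontr)
      assume "N u \<noteq> Q u - {u}"
      then obtain w where "w \<in> Q u - {u} - N u" using NQ[OF u] by blast
      then have "sum y (N u) < sum y (Q u - {u})"
        using finQ[OF u] NQ[OF u] pos_Q[OF u]
        by (intro sum_strict_mono2[where b = w]) (auto intro: less_imp_le)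
      then show False using eqN[OF u] by simp
    qed
    then have arcs: "(u, v) \<in> parcs G \<longleftrightarrow> v \<in> Q u \<and> u \<noteq> v" if "u \<in> ?V" "v \<in> ?V" for u v
      using that unfolding N_def by blast
    have "v \<in> Q u \<longleftrightarrow> u \<in> S \<or> v \<in> S \<or> (\<exists>X\<in>P. u \<in> X \<and> v \<in> X)"
      if "u \<in> ?V" "v \<in> ?V" for u v
      using that C[of u] C_eq unfolding Q_def by auto
    ultimately show "(\<Sum>X\<in>P. card X / (t - card X)) = (t - card S) / card S \<and>
      (\<forall>u\<in>?V. \<forall>v\<in>?V. (u, v) \<in> parcs G \<longleftrightarrow>
        u \<noteq> v \<and> (u \<in> S \<or> v \<in> S \<or> (\<exists>X\<in>P. u \<in> X \<and> v \<in> X)))"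
      using arcs by (intro conjI ballI; blast)
  qed
qed

text \<open>Count the excess over size 1: a part of size \<open>b\<close> contributes
  \<open>b - 1 > 0\<close>, and the total excess is \<open>(b + d) - (d + 1) = b - 1\<close>, so
  there is exactly one such part.\<close>

lemma unique_large_part:
  fixes P :: "'a set set"
  assumes "finite P" and "card P = d + 1" and "(\<Sum>X\<in>P. card X) = b + d" and "b \<ge> 2"
    and sizes: "\<forall>X\<in>P. card X = 1 \<or> card X = b"
  obtains L where "L \<in> P" "card L = b" "\<forall>X\<in>P - {L}. card X = 1"
proof -
  define P' where "P' = {X \<in> P. card X = b}"
  obtain c where c: "b = c + 1" "c \<noteq> 0"
    using \<open>b \<ge> 2\<close> by (intro that[of "b - 1"]) auto
  have "(\<Sum>X\<in>P. card X) = (\<Sum>X\<in>P. 1 + (if card X = b then c else 0))"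
    using sizes c by (intro sum.cong) auto
  also have "\<dots> = card P + card P' * c"
    unfolding sum.distrib P'_def using \<open>finite P\<close> by (simp flip: sum.inter_filter)
  finally have "card P' * c = c"
    using assms(2,3) c(1) by linarith
  then have "card P' = 1"
    using c(2) by simp
  then obtain L where "P' = {L}" by (rule card_1_singletonE)
  then show ?thesis
    using sizes by (intro that[of L]) (auto simp: P'_def)
qed

section \<open>A violating cut and the equality case\<close>

theorem theorem1p1:
  fixes G :: "'a pair_pre_digraph" and n \<delta> :: nat
  assumes "pair_graph G"
    and "Digraph_Component.connected (with_proj G)"
    and "graph_order G = n"
    and "min_degree G = \<delta>"
    and "\<delta> \<ge> 2"
    and "real n \<ge> max (5 * real \<delta>) (2 / 5 * (real \<delta>)\<^sup>2 + real \<delta>)"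
    and "graph_spectral_radius G \<ge> graph_spectral_radius (extremal_graph n \<delta>)"
    and "\<not> digraph_iso (with_proj G) (with_proj (extremal_graph n \<delta>))"
  shows "tough 1 G"
proof (rule ccontr)
  let ?V = "pverts G"
  assume "\<not> tough 1 G"
  then obtain S where S: "S \<subseteq> ?V"
    and num: "num_components (with_proj G \<restriction> (?V - S)) > 1"
      "card S < num_components (with_proj G \<restriction> (?V - S))"
    by (auto simp: tough_def not_le)
  interpret pair_graph G by fact
  note fin = pair_finite_verts
  obtain P where P_card: "num_components (with_proj G \<restriction> (?V - S)) = card P"
    and P: "finite P" "\<Union>P = ?V - S" "disjoint P" "{} \<notin> P"
    and closed: "\<And>X u v. X \<in> P \<Longrightarrow> u \<in> X \<Longrightarrow> v \<in> ?V - S \<Longrightarrow> (u, v) \<in> parcs G \<Longrightarrow> v \<in> X"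
    using induced_components_partition[OF assms(1), of "?V - S"] by blast
  have part: "X \<subseteq> ?V - S" "X \<noteq> {}" "finite X" if "X \<in> P" for X
    using that P fin by (auto intro: finite_subset)
  define s where "s = card S"
  have "s < card P" "1 < card P" using num by (auto simp: P_card s_def)
  have conn: "X = ?V"
    if "X \<subseteq> ?V" "X \<noteq> {}" "\<And>u v. u \<in> X \<Longrightarrow> v \<in> ?V \<Longrightarrow> (u, v) \<in> parcs G \<Longrightarrow> v \<in> X" for X
    using connected_closed_eq[OF assms(1,2)] that by blast
  \<comment> \<open>Without a cut each component would be closed under adjacency, hence all of
    \<open>G\<close>, yet there are two disjoint ones.\<close>
  have "S \<noteq> {}"
  proof
    assume "S = {}"
    obtain X Y where XY: "X \<in> P" "Y \<in> P" "X \<noteq> Y"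
      using \<open>1 < card P\<close> by (metis card_2_iff' card_le_Suc0_iff_eq P(1) not_less One_nat_def)
    have "X = ?V"
      using part[OF XY(1)] closed[OF XY(1)] \<open>S = {}\<close> by (intro conn) auto
    then show False
      using part[OF XY(2)] XY P(3) by (auto simp: disjoint_def)
  qed
  then have "s \<ge> 1"
    using S fin by (simp add: s_def card_gt_0_iff Suc_leI finite_subset)
  have card_V: "card ?V = n" using assms(3) by (simp add: graph_order_def)
  have "s \<le> n" using card_mono[OF fin S] card_V by (simp add: s_def)
  have sum_card: "(\<Sum>X\<in>P. card X) = n - s"
    using card_Union_disjoint[of P] P part S fin card_V
    by (simp add: s_def card_Diff_subset finite_subset disjoint_def pairwise_def disjnt_def)
  define m where "m = max 1 (real \<delta> + 1 - real s)"
  have m_le: "m \<le> card X" if "X \<in> P" for X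
  proof -
    have "\<delta> + 1 \<le> s + card X"
      unfolding s_def assms(4)[symmetric]
      using assms(1) S part[OF that] closed[OF that] by (intro degree_le_part_size) auto
    moreover have "card X \<ge> 1" using part[OF that] by (simp add: card_gt_0_iff Suc_leI)
    ultimately show ?thesis by (simp add: m_def)
  qed
  have "card P \<le> (\<Sum>X\<in>P. card X)"
    using sum_mono[of P "\<lambda>_. 1" card] part by (simp add: card_gt_0_iff Suc_leI)
  then have n_s: "n \<ge> 2 * s + 1"
    using sum_card \<open>s < card P\<close> by linarith
  have "real n \<ge> 5 * real \<delta>" "\<delta> \<ge> 2" using assms by auto
  then have n5: "n \<ge> 5 * \<delta>" by linarith
  have "real \<delta> \<ge> 2" using \<open>\<delta> \<ge> 2\<close> by simp
  obtain t where t: "real n - real \<delta> < t" "t < real n"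
    and root: "(t - real n + real \<delta>) * (t * (t - 1))
      = (real \<delta>)\<^sup>2 * (t - real n + 2 * real \<delta>)"
    by (rule extremal_root_exists[OF \<open>real \<delta> \<ge> 2\<close> \<open>real n \<ge> 5 * real \<delta>\<close>])
  have "t > 1" "t - real n + 2 * real \<delta> > 0" "n > 2 * \<delta>"
    using t \<open>real n \<ge> 5 * real \<delta>\<close> n5 \<open>\<delta> \<ge> 2\<close> \<open>real \<delta> \<ge> 2\<close> by linarith+
  define B where "B = real n - s - s * m"
  note bound = cut_sum_bound[OF \<open>\<delta> \<ge> 2\<close> assms(6) \<open>s \<ge> 1\<close> n_s t root, folded m_def, folded B_def]
  have sum_real: "(\<Sum>X\<in>P. real (card X)) = real n - s"
    using sum_card \<open>s \<le> n\<close> by (simp flip: of_nat_sum add: of_nat_diff)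
  have "m > 0" by (simp add: m_def)
  note chord = sum_convex_chord[OF P(1) \<open>s < card P\<close> sum_real m_le \<open>m > 0\<close> B_def bound(1)]
  have chord_le: "(\<Sum>X\<in>P. card X / (t - card X)) \<le> s * (m / (t - m)) + B / (t - B)"
    using chord(1) .
  have closed': "\<forall>X\<in>P. \<forall>u\<in>X. \<forall>v\<in>?V - S. (u, v) \<in> parcs G \<longrightarrow> v \<in> X"
    using closed by blast
  have card_less: "\<forall>X\<in>P. card X < t"
    using chord(3) by blast
  have sum_le: "(\<Sum>X\<in>P. card X / (t - card X)) \<le> (t - s) / s"
    using chord_le bound(2) by linarith
  obtain y where y_pos: "\<forall>v\<in>?V. 0 < y v"
    and y_le: "\<forall>u\<in>?V.
      (\<Sum>v\<in>?V. if (u, v) \<in> parcs G then y v else 0) \<le> (t - 1) * y u"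
    and y_eq: "(\<forall>u\<in>?V.
        (\<Sum>v\<in>?V. if (u, v) \<in> parcs G then y v else 0) = (t - 1) * y u) \<longrightarrow>
      (\<Sum>X\<in>P. card X / (t - card X)) = (t - card S) / card S \<and>
      (\<forall>u\<in>?V. \<forall>v\<in>?V. (u, v) \<in> parcs G \<longleftrightarrow>
        u \<noteq> v \<and> (u \<in> S \<or> v \<in> S \<or> (\<exists>X\<in>P. u \<in> X \<and> v \<in> X)))"
    by (rule cut_weight_exists[OF assms(1) S \<open>S \<noteq> {}\<close> P(1-3) closed' card_less sum_le[unfolded s_def]])
  have "?V \<noteq> {}" using S \<open>S \<noteq> {}\<close> by blast
  obtain f where f: "eigenfunction G (graph_spectral_radius G) f"
    using graph_spectral_radius_eigenfunction[OF assms(1) \<open>?V \<noteq> {}\<close>] by blast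
  \<comment> \<open>With the spectral hypothesis this yields
    \<open>t - 1 \<le> graph_spectral_radius G\<close>, the premise for comparing an eigenfunction
    of \<open>G\<close> with the supersolution \<open>y\<close>.\<close>
  have "t - 1 \<le> graph_spectral_radius (extremal_graph n \<delta>)"
  proof -
    have "pverts (extremal_graph n \<delta>) \<noteq> {}"
      using \<open>\<delta> \<ge> 2\<close> by (auto simp: pverts_extremal_graph lessThan_empty_iff)
    moreover have "\<exists>f. eigenfunction (extremal_graph n \<delta>) (t - 1) f"
      using \<open>\<delta> \<ge> 2\<close> \<open>n > 2 * \<delta>\<close> \<open>t > 1\<close> \<open>t - real n + 2 * real \<delta> > 0\<close> root
      by (intro extremal_graph_eigenfunction) linarith+
    ultimately show ?thesis
      using eigenfunction_le_graph_spectral_radius[OF pair_graph_extremal_graph] by blast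
  qed
  then have "t - 1 \<le> graph_spectral_radius G"
    using assms(7) by linarith
  have "(\<Sum>v\<in>?V. if (u, v) \<in> parcs G then y v else 0) = (t - 1) * y u" if "u \<in> ?V" for u
    by (rule eigenfunction_supersolution_eq[OF f fin])
      (fact conn y_pos[rule_format] y_le[rule_format] \<open>t - 1 \<le> graph_spectral_radius G\<close> that)+
  then have eqs: "(\<Sum>X\<in>P. card X / (t - card X)) = (t - card S) / card S"
    "\<forall>u\<in>?V. \<forall>v\<in>?V. (u, v) \<in> parcs G \<longleftrightarrow>
      u \<noteq> v \<and> (u \<in> S \<or> v \<in> S \<or> (\<exists>X\<in>P. u \<in> X \<and> v \<in> X))"
    using y_eq by blast+
  have arcs: "(u, v) \<in> parcs G \<longleftrightarrow>
      u \<noteq> v \<and> (u \<in> S \<or> v \<in> S \<or> (\<exists>X\<in>P. u \<in> X \<and> v \<in> X))" if "u \<in> ?V" "v \<in> ?V" for u v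
    using eqs(2) that by blast
  have sum_eq: "(\<Sum>X\<in>P. card X / (t - card X)) = (t - s) / s"
    using eqs(1) unfolding s_def .
  \<comment> \<open>The chain from the sum over \<open>P\<close> through the chord value to
    \<open>(t - s) / s\<close> is now tight. Equality in its second link gives
    \<open>s = \<delta>\<close>, equality in its first the part sizes.\<close>
  then have "s = \<delta>"
    using bound chord_le by linarith
  then have "m = 1" and B_eq: "B = real n - 2 * real \<delta>" by (simp_all add: m_def B_def)
  have "(\<Sum>X\<in>P. card X / (t - card X)) = s * (m / (t - m)) + B / (t - B)"
    using sum_eq chord_le bound(2) by linarith
  then have sizes: "card P = s + 1 \<and> (\<forall>X\<in>P. real (card X) = m \<or> real (card X) = B)"
    using chord(2) by blast
  have "card X = 1 \<or> card X = n - 2 * \<delta>" if "X \<in> P" for X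
  proof -
    have "real (card X) = 1 \<or> real (card X) = real n - 2 * real \<delta>"
      using sizes that unfolding \<open>m = 1\<close> B_eq by blast
    then show ?thesis using \<open>n > 2 * \<delta>\<close> by (elim disjE) linarith+
  qed
  then have "\<forall>X\<in>P. card X = 1 \<or> card X = n - 2 * \<delta>" by blast
  \<comment> \<open>\<open>n \<ge> 5 * \<delta>\<close> keeps the size
    \<open>n - 2 * \<delta>\<close> apart from 1, so the large part \<open>L\<close> can be
    identified by counting.\<close>
  moreover have "card P = \<delta> + 1" "(\<Sum>X\<in>P. card X) = (n - 2 * \<delta>) + \<delta>" "n - 2 * \<delta> \<ge> 2"
    using sizes sum_card \<open>s = \<delta>\<close> n5 \<open>\<delta> \<ge> 2\<close> by auto
  ultimately obtain L where L: "L \<in> P" "card L = n - 2 * \<delta>" "\<forall>X\<in>P - {L}. card X = 1"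
    by (metis unique_large_part[OF P(1)])
  define R where "R = ?V - S - L"
  have "L \<subseteq> ?V - S" using part L by blast
  have "card R = \<delta>"
    using S \<open>L \<subseteq> ?V - S\<close> fin card_V L n5 \<open>s = \<delta>\<close>
    by (simp add: R_def card_Diff_subset finite_subset s_def)
  \<comment> \<open>Distinct vertices cannot share a singleton part, so the only arcs inside parts
    are those inside \<open>L\<close>; the union \<open>R\<close> of the other parts is
    independent.\<close>
  have same_part: "(\<exists>X\<in>P. u \<in> X \<and> v \<in> X) \<longleftrightarrow> u \<in> L \<and> v \<in> L" if "u \<noteq> v" for u v
  proof
    assume "\<exists>X\<in>P. u \<in> X \<and> v \<in> X"
    then obtain X where X: "X \<in> P" "u \<in> X" "v \<in> X" by blast
    then have "card X \<noteq> 1" using that by (metis card_1_singletonE singletonD)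
    then show "u \<in> L \<and> v \<in> L" using L(3) X by blast
  qed (use L in blast)
  have "digraph_iso (with_proj G) (with_proj (extremal_graph n \<delta>))"
  proof (rule digraph_iso_extremal_graphI[OF assms(1)])
    show "?V = S \<union> L \<union> R" "S \<inter> L = {}" "S \<inter> R = {}" "L \<inter> R = {}"
      using S \<open>L \<subseteq> ?V - S\<close> by (auto simp: R_def)
    show "card S = \<delta>" "card L = n - 2 * \<delta>" "card R = \<delta>"
      using \<open>s = \<delta>\<close> L \<open>card R = \<delta>\<close> by (auto simp: s_def)
    show "(u, v) \<in> parcs G \<longleftrightarrow> u \<noteq> v \<and> (u \<in> S \<or> v \<in> S \<or> u \<in> L \<and> v \<in> L)"
      if "u \<in> ?V" "v \<in> ?V" for u v
      using arcs[OF that] same_part by blast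
  qed
  then show False using assms(8) by blast
qed

end
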